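(* Let $G$ be an $r$-regular, connected, non-bipartite graph with $r\geq 2$, having $n$ vertices $v_1,\dots,v_n$ and $m$ edges $e_1,\dots,e_m$. Let $R_G$ be its $n\times m$ vertex-edge incidence matrix. Let $2r=q_0>q_1>\cdots>q_d$ be all the distinct signless Laplacian eigenvalues of $G$, where $q_i$ has multiplicity $l_i$, and let $x_1^{(i)},\dots,x_{l_i}^{(i)}$ be orthonormal eigenvectors of $Q_G$ for $q_i$ ($i=0,\dots,d$). Let $y_1,\dots,y_{m-n}$ be orthonormal vectors in $\mathbb{R}^m$ with $R_Gy_k=0$. Then the signless Laplacian spectrum of $\mathcal{Q}(G)$ consists precisely of: (i) the eigenvalue $2r-2$ with multiplicity $m-n$, with orthogonal eigenvectors $Y_k=\frac{1}{\|y_k\|}\begin{pmatrix}0\\ y_k\end{pmatrix}$, $k=1,\dots,m-n$; (ii) the eigenvalues $q_{i\pm}=\frac{3r+q_i-2\pm\sqrt{(q_i+r-2)^2+4q_i}}{2}$, $i=0,\dots,d$ (each with multiplicity $l_i$), with orthogonal eigenvectors $$X_{i\pm}^{j}=\frac{1}{\sqrt{(q_{i\pm}+2-2r-q_i)^2+q_i}}\begin{pmatrix}(q_{i\pm}+2-2r-q_i)x_j^{(i)}\\ R_G^Tx_j^{(i)}\end{pmatrix},\quad j=1,\dots,l_i,$$ and all the vectors $Y_k$, $X_{i\pm}^j$ are mutually orthogonal.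
   Context: For a graph $H$, the signless Laplacian matrix is $Q_H=D(H)+A(H)$, where $A(H)$ is the adjacency matrix and $D(H)$ the diagonal degree matrix; its eigenvalues are the signless Laplacian eigenvalues of $H$. The vertex-edge incidence matrix $R_G=(r_{ij})$ has $r_{ij}=1$ if $v_i$ is incident to $e_j$ and $0$ otherwise. The $\mathcal{Q}$-graph $\mathcal{Q}(G)$ is obtained from $G$ by inserting a new vertex into each edge of $G$ (the new vertex on $e_j$ is adjacent to both endpoints of $e_j$, the original edge being replaced) and joining two new vertices by an edge whenever the corresponding edges of $G$ share an endpoint. Vertices of $\mathcal{Q}(G)$ are ordered as $v_1,\dots,v_n$ followed by the new vertices corresponding to $e_1,\dots,e_m$; block vectors $\begin{pmatrix}a\\ b\end{pmatrix}$ have $a\in\mathbb{R}^n$, $b\in\mathbb{R}^m$ in this order. *)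

theory Defs
  imports "Jordan_Normal_Form.Spectral_Radius"
begin

text \<open>A finite simple graph is given by its vertex set \<open>V\<close> and its set \<open>E\<close> of edges, each edge
  being the two-element set of its endpoints.\<close>

definition simple_graph :: "'a set \<Rightarrow> 'a set set \<Rightarrow> bool" where
  "simple_graph V E \<longleftrightarrow> finite V \<and> (\<forall>e\<in>E. \<exists>u\<in>V. \<exists>v\<in>V. u \<noteq> v \<and> e = {u, v})"

definition vertex_degree :: "'a set set \<Rightarrow> 'a \<Rightarrow> nat" where
  "vertex_degree E v = card {e \<in> E. v \<in> e}"

definition regular_graph :: "'a set \<Rightarrow> 'a set set \<Rightarrow> nat \<Rightarrow> bool" where
  "regular_graph V E r \<longleftrightarrow> (\<forall>v\<in>V. vertex_degree E v = r)"

definition connected_graph :: "'a set \<Rightarrow> 'a set set \<Rightarrow> bool" where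
  "connected_graph V E \<longleftrightarrow> V \<noteq> {} \<and> (\<forall>u\<in>V. \<forall>v\<in>V. (u, v) \<in> {(a, b). {a, b} \<in> E}\<^sup>*)"

definition bipartite_graph :: "'a set \<Rightarrow> 'a set set \<Rightarrow> bool" where
  "bipartite_graph V E \<longleftrightarrow>
     (\<exists>A B. A \<union> B = V \<and> A \<inter> B = {} \<and> (\<forall>e\<in>E. \<exists>a\<in>A. \<exists>b\<in>B. e = {a, b}))"

text \<open>Matrices of a graph are taken with respect to a list \<open>vs\<close> enumerating the vertices
  (and a list \<open>es\<close> enumerating the edges) without repetition.\<close>

definition adjacency_matrix :: "'a list \<Rightarrow> 'a set set \<Rightarrow> real mat" where
  "adjacency_matrix vs E =
     mat (length vs) (length vs) (\<lambda>(i, j). if {vs ! i, vs ! j} \<in> E then 1 else 0)"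

definition degree_matrix :: "'a list \<Rightarrow> 'a set set \<Rightarrow> real mat" where
  "degree_matrix vs E =
     mat (length vs) (length vs) (\<lambda>(i, j). if i = j then real (vertex_degree E (vs ! i)) else 0)"

definition signless_laplacian :: "'a list \<Rightarrow> 'a set set \<Rightarrow> real mat" where
  "signless_laplacian vs E = degree_matrix vs E + adjacency_matrix vs E"

definition incidence_matrix :: "'a list \<Rightarrow> 'a set list \<Rightarrow> real mat" where
  "incidence_matrix vs es =
     mat (length vs) (length es) (\<lambda>(i, j). if vs ! i \<in> es ! j then 1 else 0)"

text \<open>The eigenvalues with their multiplicities. For a real symmetric matrix all roots of the
  characteristic polynomial are real, so none are lost by taking roots over the reals.\<close>

definition signless_laplacian_spectrum :: "'a list \<Rightarrow> 'a set set \<Rightarrow> real multiset" where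
  "signless_laplacian_spectrum vs E = proots (char_poly (signless_laplacian vs E))"

text \<open>The \<open>\<Q>\<close>-graph: \<open>Inl v\<close> is the original vertex \<open>v\<close>, and \<open>Inr e\<close> is the new vertex inserted
  into the edge \<open>e\<close>.\<close>

definition Q_graph_edges :: "'a set set \<Rightarrow> ('a + 'a set) set set" where
  "Q_graph_edges E =
     {{Inl v, Inr e} | v e. e \<in> E \<and> v \<in> e} \<union>
     {{Inr e, Inr f} | e f. e \<in> E \<and> f \<in> E \<and> e \<noteq> f \<and> e \<inter> f \<noteq> {}}"

definition Q_graph_vertices :: "'a list \<Rightarrow> 'a set list \<Rightarrow> ('a + 'a set) list" where
  "Q_graph_vertices vs es = map Inl vs @ map Inr es"

definition vec_norm2 :: "real vec \<Rightarrow> real" where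
  "vec_norm2 v = sqrt (v \<bullet> v)"

text \<open>The number \<open>q\<^sub>i\<^sub>\<plusminus>\<close> for \<open>q = q\<^sub>i\<close>, with \<open>s = 1\<close> for the sign plus and \<open>s = -1\<close> for minus.\<close>

definition q_pm :: "nat \<Rightarrow> real \<Rightarrow> real \<Rightarrow> real" where
  "q_pm r s q = (3 * real r + q - 2 + s * sqrt ((q + real r - 2)\<^sup>2 + 4 * q)) / 2"

definition Y_vec :: "nat \<Rightarrow> real vec \<Rightarrow> real vec" where
  "Y_vec n y = (1 / vec_norm2 y) \<cdot>\<^sub>v (0\<^sub>v n @\<^sub>v y)"

definition X_vec :: "real mat \<Rightarrow> nat \<Rightarrow> real \<Rightarrow> real \<Rightarrow> real vec \<Rightarrow> real vec" where
  "X_vec R r s q x =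
     (1 / sqrt ((q_pm r s q + 2 - 2 * real r - q)\<^sup>2 + q)) \<cdot>\<^sub>v
       (((q_pm r s q + 2 - 2 * real r - q) \<cdot>\<^sub>v x) @\<^sub>v (transpose_mat R *\<^sub>v x))"

end

theory Submission
  imports Defs
begin

text \<open>In block form the signless Laplacian of \<open>\<Q>(G)\<close> is \<open>((r I, R), (R\<^sup>T, (2r - 2) I + R\<^sup>T R))\<close>, while
  \<open>R R\<^sup>T\<close> is the signless Laplacian of \<open>G\<close>. Hence \<open>(0, y)\<close> with \<open>R y = 0\<close> is an eigenvector for
  \<open>2r - 2\<close>, and \<open>(a x, R\<^sup>T x)\<close> is an eigenvector for \<open>a + 2r - 2 + q\<close> as soon as
  \<open>a\<^sup>2 + (q + r - 2) a = q\<close>, whose two roots give \<open>q\<^sub>i\<^sub>\<plusminus>\<close>. Connectedness and non-bipartiteness force \<open>q > 0\<close>,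
  which together with \<open>r \<ge> 2\<close> makes all these eigenvalues distinct and the eigenvectors nonzero. As the characteristic polynomial of a
  real symmetric matrix splits, the \<open>l\<^sub>i\<close> sum to \<open>n\<close>; so there are \<open>(m - n) + 2n = m + n\<close> pairwise
  orthogonal eigenvectors, which diagonalise the matrix and determine all multiplicities.\<close>

section \<open>Spectra of real symmetric matrices\<close>

lemma real_scalar_prod_self_eq_0_iff:
  fixes v :: "real vec"
  assumes "v \<in> carrier_vec n"
  shows "v \<bullet> v = 0 \<longleftrightarrow> v = 0\<^sub>v n"
proof -
  have "conjugate v = v"
    by (intro eq_vecI) auto
  then show ?thesis
    using conjugate_square_eq_0_vec[OF assms] by simp
qed

lemma scalar_prod_mult_mat_vec_symmetric:
  fixes A :: "'a :: comm_semiring_0 mat"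
  assumes "A \<in> carrier_mat n n" "transpose_mat A = A"
    and "v \<in> carrier_vec n" "w \<in> carrier_vec n"
  shows "(A *\<^sub>v v) \<bullet> w = v \<bullet> (A *\<^sub>v w)"
  using transpose_vec_mult_scalar[OF assms(1,4,3)] assms(2) by simp

text \<open>Moving the matrix across the product gives
  \<open>a * (v \<bullet> w) = b * (v \<bullet> w)\<close>. This settles every orthogonality claim
  between eigenvectors of different eigenvalues.\<close>

lemma symmetric_eigenvectors_orthogonal:
  fixes A :: "'a :: idom mat"
  assumes A: "A \<in> carrier_mat n n" "transpose_mat A = A"
    and v: "eigenvector A v a" and w: "eigenvector A w b" and "a \<noteq> b"
  shows "v \<bullet> w = 0"
proof -
  have dims: "v \<in> carrier_vec n" "w \<in> carrier_vec n"
    using A v w by (auto simp: eigenvector_def)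
  have "a * (v \<bullet> w) = (A *\<^sub>v v) \<bullet> w"
    using v dims by (simp add: eigenvector_def)
  also have "\<dots> = v \<bullet> (A *\<^sub>v w)"
    using scalar_prod_mult_mat_vec_symmetric[OF A] dims by blast
  also have "\<dots> = b * (v \<bullet> w)"
    using w dims by (simp add: eigenvector_def)
  finally show ?thesis
    using \<open>a \<noteq> b\<close> by simp
qed

text \<open>The vectors are the columns of an invertible matrix conjugating \<open>A\<close> to a
  diagonal one. A full orthogonal system thus fixes all algebraic multiplicities at once, without
  normalisation.\<close>

lemma char_poly_orthogonal_eigenvectors:
  fixes A :: "real mat" and v :: "'i \<Rightarrow> real vec" and ev :: "'i \<Rightarrow> real"
  assumes A: "A \<in> carrier_mat n n"
    and I: "finite I" "card I = n"
    and eigen: "\<And>i. i \<in> I \<Longrightarrow> eigenvector A (v i) (ev i)"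
    and orth: "\<And>i j. i \<in> I \<Longrightarrow> j \<in> I \<Longrightarrow> i \<noteq> j \<Longrightarrow> v i \<bullet> v j = 0"
  shows "char_poly A = (\<Prod>i\<in>I. [:- ev i, 1:])"
proof -
  obtain h where h: "bij_betw h {0..<n} I"
    using ex_bij_betw_nat_finite[OF I(1)] I(2) by blast
  then have hI: "h i \<in> I" if "i < n" for i
    using that by (auto simp: bij_betw_def)
  have h_eq: "h i = h j \<longleftrightarrow> i = j" if "i < n" "j < n" for i j
    using h that by (auto simp: bij_betw_def inj_on_def)
  have vc: "v (h i) \<in> carrier_vec n" "v (h i) \<noteq> 0\<^sub>v n"
    "A *\<^sub>v v (h i) = ev (h i) \<cdot>\<^sub>v v (h i)" if "i < n" for i
    using eigen[OF hI[OF that]] A by (auto simp: eigenvector_def)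
  define P where "P = mat n n (\<lambda>(a, j). v (h j) $ a)"
  \<comment> \<open>By orthogonality, the transpose of \<open>P\<close> with each row divided by the
    squared norm of its vector is a left inverse of \<open>P\<close>.\<close>
  define W where "W = mat n n (\<lambda>(j, a). v (h j) $ a / (v (h j) \<bullet> v (h j)))"
  define D where "D = mat n n (\<lambda>(i, j). if i = j then ev (h i) else 0)"
  have carrier: "P \<in> carrier_mat n n" "W \<in> carrier_mat n n" "D \<in> carrier_mat n n"
    by (auto simp: P_def W_def D_def)
  have colP: "col P j = v (h j)" if "j < n" for j
    using that vc(1)[OF that] by (intro eq_vecI) (auto simp: P_def)
  have rowW: "row W j = (1 / (v (h j) \<bullet> v (h j))) \<cdot>\<^sub>v v (h j)" if "j < n" for j
    using that vc(1)[OF that] by (intro eq_vecI) (auto simp: W_def)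
  have WP: "W * P = 1\<^sub>m n"
  proof (intro eq_matI)
    fix i j assume "i < dim_row (1\<^sub>m n :: real mat)" "j < dim_col (1\<^sub>m n :: real mat)"
    then have ij: "i < n" "j < n" by auto
    have nz: "v (h i) \<bullet> v (h i) \<noteq> 0"
      using real_scalar_prod_self_eq_0_iff vc ij by blast
    have "(W * P) $$ (i, j) = (v (h i) \<bullet> v (h j)) / (v (h i) \<bullet> v (h i))"
      using ij carrier vc(1)[OF ij(1)] vc(1)[OF ij(2)] by (simp add: rowW colP)
    also have "\<dots> = (if i = j then 1 else 0)"
      using nz orth[OF hI hI] h_eq ij by auto
    finally show "(W * P) $$ (i, j) = 1\<^sub>m n $$ (i, j)"
      using ij by simp
  qed (use carrier in auto)
  then have PW: "P * W = 1\<^sub>m n"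
    using mat_mult_left_right_inverse carrier by blast
  have AP: "A * P = P * D"
  proof (intro eq_matI)
    fix i j assume "i < dim_row (P * D)" "j < dim_col (P * D)"
    then have ij: "i < n" "j < n" using carrier by auto
    have "(A * P) $$ (i, j) = (A *\<^sub>v v (h j)) $ i"
      using ij A carrier by (simp add: colP)
    also have "\<dots> = ev (h j) * v (h j) $ i"
      using vc[OF ij(2)] ij by simp
    also have "\<dots> = (\<Sum>k\<in>{0..<n}. if k = j then v (h k) $ i * ev (h k) else 0)"
      using ij by (subst sum.delta) (auto simp: mult.commute)
    also have "\<dots> = (\<Sum>k\<in>{0..<n}. P $$ (i, k) * D $$ (k, j))"
      using ij by (intro sum.cong) (auto simp: P_def D_def)
    also have "\<dots> = (P * D) $$ (i, j)"
      using ij carrier by (auto simp: times_mat_def scalar_prod_def intro!: sum.cong)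
    finally show "(A * P) $$ (i, j) = (P * D) $$ (i, j)" .
  qed (use A carrier in auto)
  have "A = A * (P * W)"
    using A PW by simp
  also have "\<dots> = P * D * W"
    using A carrier AP by (metis assoc_mult_mat)
  finally have "similar_mat A D"
    using similar_matI[of A D P W n] A carrier WP PW by auto
  then have "char_poly A = char_poly D"
    by (rule char_poly_similar)
  also have "\<dots> = (\<Prod>a\<leftarrow>diag_mat D. [:- a, 1:])"
    by (intro char_poly_upper_triangular[OF carrier(3)]) (auto simp: D_def)
  also have "diag_mat D = map (ev \<circ> h) [0..<n]"
    by (auto simp: diag_mat_def D_def)
  also have "(\<Prod>a\<leftarrow>map (ev \<circ> h) [0..<n]. [:- a, 1:]) = (\<Prod>i\<in>{0..<n}. [:- ev (h i), 1:])"
    using prod.distinct_set_conv_list[of "[0..<n]" "\<lambda>i. [:- ev (h i), 1:]"] by (simp add: o_def)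
  also have "\<dots> = (\<Prod>i\<in>I. [:- ev i, 1:])"
    by (rule prod.reindex_bij_betw[OF h])
  finally show ?thesis .
qed

lemma proots_prod_list_linear_factors:
  "proots (\<Prod>a\<leftarrow>as. [:- a, 1:]) = mset (as :: 'a :: idom list)"
proof (induction as)
  case (Cons a as)
  have "(\<Prod>a\<leftarrow>as. [:- a, 1:]) \<noteq> 0"
    by (auto simp: prod_list_zero_iff)
  then show ?case
    using Cons by (simp add: proots_mult del: mult_pCons_left)
qed simp

text \<open>For a complex eigenvector \<open>v\<close> with eigenvalue \<open>a\<close>, moving the matrix across the Hermitian product of \<open>v\<close>
  with itself gives \<open>a = cnj a\<close>, so the characteristic polynomial already splits over the reals.\<close>

lemma size_proots_char_poly_symmetric:
  fixes A :: "real mat"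
  assumes A: "A \<in> carrier_mat n n" "transpose_mat A = A"
  shows "size (proots (char_poly A)) = n"
proof -
  interpret cpoly: map_poly_inj_idom_hom complex_of_real ..
  define C where "C = map_mat complex_of_real A"
  have C: "C \<in> carrier_mat n n" "transpose_mat C = C"
    using A map_mat_transpose[of complex_of_real A] by (auto simp: C_def)
  have real: "a \<in> \<real>" if "eigenvalue C a" for a
  proof -
    obtain v where v: "v \<in> carrier_vec n" "v \<noteq> 0\<^sub>v n" "C *\<^sub>v v = a \<cdot>\<^sub>v v"
      using \<open>eigenvalue C a\<close> C(1) by (auto simp: eigenvalue_def eigenvector_def)
    have conj_row: "conjugate (row C i) = row C i" if "i < n" for i
      using that A(1) by (intro eq_vecI) (auto simp: C_def)
    \<comment> \<open>The entries of \<open>C\<close> are real, so conjugation turns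
      \<open>v\<close> into an eigenvector for the conjugate eigenvalue.\<close>
    have "C *\<^sub>v conjugate v = conjugate (C *\<^sub>v v)"
    proof (intro eq_vecI)
      fix i assume "i < dim_vec (conjugate (C *\<^sub>v v))"
      then have i: "i < n" using C by auto
      have "conjugate (row C i \<bullet> v) = conjugate (row C i) \<bullet> conjugate v"
        using i C v by (intro conjugate_sprod_vec[of _ n]) auto
      then show "(C *\<^sub>v conjugate v) $ i = conjugate (C *\<^sub>v v) $ i"
        using i C v(1,2) conj_row by auto
    qed (use C in auto)
    also have "\<dots> = conjugate a \<cdot>\<^sub>v conjugate v"
      by (simp add: v(3) conjugate_smult_vec)
    finally have conj: "C *\<^sub>v conjugate v = conjugate a \<cdot>\<^sub>v conjugate v" .
    have "a * (v \<bullet>c v) = (C *\<^sub>v v) \<bullet>c v"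
      using v by simp
    also have "\<dots> = v \<bullet> (C *\<^sub>v conjugate v)"
      by (rule scalar_prod_mult_mat_vec_symmetric[OF C]) (use v in auto)
    also have "\<dots> = conjugate a * (v \<bullet>c v)"
      using v by (simp add: conj)
    finally have "a = conjugate a"
      using v conjugate_square_eq_0_vec[OF v(1)] by simp
    then show "a \<in> \<real>"
      by (simp add: complex_is_Real_iff complex_eq_iff)
  qed
  obtain as where as: "char_poly C = (\<Prod>a\<leftarrow>as. [:- a, 1:])" "length as = n"
    using char_poly_factorized[OF C(1)] by blast
  have "a \<in> \<real>" if "a \<in> set as" for a
  proof (rule real)
    show "eigenvalue C a"
      unfolding eigenvalue_root_char_poly[OF C(1)] as(1)
      using that by (auto simp: poly_prod_list prod_list_zero_iff)
  qed
  then have re: "map (complex_of_real \<circ> Re) as = as"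
    by (auto intro!: map_idI simp: of_real_Re)
  have "map_poly complex_of_real (char_poly A) = (\<Prod>a\<leftarrow>as. [:- a, 1:])"
    using as(1) by (simp add: C_def of_real_hom.char_poly_hom[OF A(1)])
  also have "\<dots> = (\<Prod>a\<leftarrow>map (complex_of_real \<circ> Re) as. [:- a, 1:])"
    by (simp only: re)
  also have "\<dots> = map_poly complex_of_real (\<Prod>a\<leftarrow>map Re as. [:- a, 1:])"
    by (simp add: cpoly.hom_prod_list o_def)
  \<comment> \<open>The coefficientwise embedding of real into complex polynomials is
    injective.\<close>
  finally have "char_poly A = (\<Prod>a\<leftarrow>map Re as. [:- a, 1:])"
    by simp
  then have "proots (char_poly A) = mset (map Re as)"
    by (simp only: proots_prod_list_linear_factors)
  then show ?thesis
    using as(2) by simp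
qed

section \<open>Incidence matrices and the \<open>\<Q>\<close>-graph\<close>

lemma sum_indicator_nth:
  assumes "distinct xs"
  shows "(\<Sum>k\<in>{0..<length xs}. if P (xs ! k) then 1 else 0) = real (card {x \<in> set xs. P x})"
proof -
  have "(\<Sum>k\<in>{0..<length xs}. if P (xs ! k) then 1 else 0) = (\<Sum>x\<in>set xs. if P x then 1 else 0 :: real)"
    by (intro sum.reindex_bij_betw bij_betw_nth assms) (simp_all add: lessThan_atLeast0)
  then show ?thesis
    by (simp add: sum.If_cases Int_def)
qed

lemma signless_laplacian_carrier [simp]:
  "signless_laplacian vs E \<in> carrier_mat (length vs) (length vs)"
  by (simp add: signless_laplacian_def degree_matrix_def adjacency_matrix_def)

lemma signless_laplacian_symmetric [simp]:
  "transpose_mat (signless_laplacian vs E) = signless_laplacian vs E"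
  by (auto simp: signless_laplacian_def degree_matrix_def adjacency_matrix_def insert_commute)

section \<open>Adjacency and degrees of original vertices in the \<open>\<Q>\<close>-graph\<close>

lemma Inl_Inl_notin_Q_graph_edges [simp]: "{Inl u, Inl v} \<notin> Q_graph_edges E"
  by (auto simp: Q_graph_edges_def doubleton_eq_iff)

lemma Inl_Inr_in_Q_graph_edges [simp]: "{Inl v, Inr e} \<in> Q_graph_edges E \<longleftrightarrow> e \<in> E \<and> v \<in> e"
  by (auto simp: Q_graph_edges_def doubleton_eq_iff)

lemma Inr_Inl_in_Q_graph_edges [simp]: "{Inr e, Inl v} \<in> Q_graph_edges E \<longleftrightarrow> e \<in> E \<and> v \<in> e"
  by (simp add: insert_commute[of "Inr e"])

lemma Inr_Inr_in_Q_graph_edges [simp]: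
  "{Inr e, Inr f} \<in> Q_graph_edges E \<longleftrightarrow> e \<in> E \<and> f \<in> E \<and> e \<noteq> f \<and> e \<inter> f \<noteq> {}"
  by (auto simp: Q_graph_edges_def doubleton_eq_iff)

text \<open>On the diagonal of the adjacency matrix the pair collapses to a singleton, which needs
  its own rewrite rule.\<close>

lemma Inr_notin_Q_graph_edges [simp]: "{Inr e} \<notin> Q_graph_edges E"
  using Inr_Inr_in_Q_graph_edges[of e e E] by simp

text \<open>An original vertex is joined only to the new vertices on its own edges, one for
  each.\<close>

lemma vertex_degree_Q_graph_Inl: "vertex_degree (Q_graph_edges E) (Inl v) = vertex_degree E v"
proof -
  have "{d \<in> Q_graph_edges E. Inl v \<in> d} = (\<lambda>e. {Inl v, Inr e}) ` {e \<in> E. v \<in> e}"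
    by (auto simp: Q_graph_edges_def)
  moreover have "inj_on (\<lambda>e. {Inl v, Inr e}) {e \<in> E. v \<in> e}"
    by (auto simp: inj_on_def doubleton_eq_iff)
  ultimately show ?thesis
    by (simp add: vertex_degree_def card_image)
qed

section \<open>Incidence products, degree counts and positivity\<close>

locale enumerated_graph =
  fixes V :: "'a set" and E :: "'a set set" and vs :: "'a list" and es :: "'a set list"
  assumes simple: "simple_graph V E"
    and vs: "distinct vs" "set vs = V"
    and es: "distinct es" "set es = E"
begin

abbreviation "R \<equiv> incidence_matrix vs es"
abbreviation "n \<equiv> length vs"
abbreviation "m \<equiv> length es"

lemma finite_V: "finite V"
  using vs(2)[symmetric] by simp

lemma finite_E: "finite E"
  using es(2)[symmetric] by simp

lemma edgeE:
  assumes "e \<in> E"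
  obtains u v where "u \<in> V" "v \<in> V" "u \<noteq> v" "e = {u, v}"
proof -
  have "\<exists>u\<in>V. \<exists>v\<in>V. u \<noteq> v \<and> e = {u, v}"
    using simple assms by (simp add: simple_graph_def)
  then show ?thesis
    by (elim bexE conjE) (rule that)
qed

lemma edge_subset: "e \<in> E \<Longrightarrow> e \<subseteq> V"
  by (erule edgeE) simp

lemma card_edge: "e \<in> E \<Longrightarrow> card e = 2"
  by (erule edgeE) simp

lemma finite_edge: "e \<in> E \<Longrightarrow> finite e"
  by (erule edgeE) simp

lemma edge_eq_doubleton:
  assumes "e \<in> E" "u \<in> e" "v \<in> e" "u \<noteq> v"
  shows "e = {u, v}"
proof -
  obtain a b where "e = {a, b}"
    using assms(1) by (rule edgeE)
  then show ?thesis
    using assms(2-4) by auto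
qed

text \<open>Two common vertices would make both edges the same doubleton. Hence the size of an
  intersection is the adjacency indicator of the two new vertices.\<close>

lemma card_edge_Int:
  assumes "e \<in> E" "f \<in> E" "e \<noteq> f"
  shows "card (e \<inter> f) = (if e \<inter> f \<noteq> {} then 1 else 0)"
proof -
  have "\<exists>z. e \<inter> f = {z}" if "x \<in> e" "x \<in> f" for x
  proof (intro exI[of _ x] equalityI subsetI)
    fix z assume z: "z \<in> e \<inter> f"
    show "z \<in> {x}"
    proof (rule ccontr)
      assume "z \<notin> {x}"
      then have "e = {x, z}" "f = {x, z}"
        using edge_eq_doubleton[of e x z] edge_eq_doubleton[of f x z] assms z that by simp_all
      then show False using assms(3) by simp
    qed
  qed (use that in simp)
  then have "e \<inter> f = {} \<or> (\<exists>z. e \<inter> f = {z})"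
    by blast
  then show ?thesis
    by (elim disjE exE) simp_all
qed

lemma incidence_carrier [simp]: "R \<in> carrier_mat n m"
  by (simp add: incidence_matrix_def)

lemma transpose_incidence_mult_carrier [simp]: "transpose_mat R *\<^sub>v x \<in> carrier_vec m"
  by (rule carrier_vecI) (simp add: incidence_matrix_def)

text \<open>Entry \<open>(i, j)\<close> counts the edges containing both vertices: the degree on the
  diagonal, at most one edge off it.\<close>

lemma incidence_mult_transpose: "R * transpose_mat R = signless_laplacian vs E"
proof (intro eq_matI)
  fix i j assume "i < dim_row (signless_laplacian vs E)" "j < dim_col (signless_laplacian vs E)"
  then have ij: "i < n" "j < n"
    by (simp_all add: signless_laplacian_def adjacency_matrix_def)
  have "(R * transpose_mat R) $$ (i, j) =
      (\<Sum>k\<in>{0..<m}. if vs ! i \<in> es ! k \<and> vs ! j \<in> es ! k then 1 else 0)"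
    using ij by (auto simp: incidence_matrix_def scalar_prod_def intro!: sum.cong)
  also have "\<dots> = real (card {e \<in> E. vs ! i \<in> e \<and> vs ! j \<in> e})"
    using sum_indicator_nth[OF es(1)] es(2) by simp
  also have "\<dots> = signless_laplacian vs E $$ (i, j)"
  proof (cases "i = j")
    case True
    \<comment> \<open>There are no loops, so the adjacency part vanishes on the diagonal.\<close>
    have "{vs ! i} \<notin> E"
      using card_edge by fastforce
    then show ?thesis
      using True ij
      by (simp add: signless_laplacian_def adjacency_matrix_def degree_matrix_def vertex_degree_def)
  next
    case False
    then have "vs ! i \<noteq> vs ! j"
      using ij vs by (simp add: nth_eq_iff_index_eq)
    then have "e \<in> E \<and> vs ! i \<in> e \<and> vs ! j \<in> e \<longleftrightarrow> {vs ! i, vs ! j} \<in> E \<and> e = {vs ! i, vs ! j}" for e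
      using edge_eq_doubleton[of e "vs ! i" "vs ! j"] by fast
    then have "{e \<in> E. vs ! i \<in> e \<and> vs ! j \<in> e} = (if {vs ! i, vs ! j} \<in> E then {{vs ! i, vs ! j}} else {})"
      by simp
    then show ?thesis
      using False ij
      by (simp add: signless_laplacian_def adjacency_matrix_def degree_matrix_def)
  qed
  finally show "(R * transpose_mat R) $$ (i, j) = signless_laplacian vs E $$ (i, j)" .
qed (simp_all add: incidence_matrix_def signless_laplacian_def adjacency_matrix_def)

text \<open>Common endpoints are counted: 2 on the diagonal, 0 or 1 elsewhere. So
  \<open>transpose_mat R * R\<close> is twice the identity plus the adjacency matrix of the new
  vertices.\<close>

lemma transpose_incidence_mult_index:
  assumes "i < m" "j < m"
  shows "(transpose_mat R * R) $$ (i, j) = real (card (es ! i \<inter> es ! j))"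
proof -
  have "(transpose_mat R * R) $$ (i, j) =
      (\<Sum>k\<in>{0..<n}. if vs ! k \<in> es ! i \<inter> es ! j then 1 else 0)"
    using assms by (auto simp: incidence_matrix_def scalar_prod_def intro!: sum.cong)
  also have "\<dots> = real (card {v \<in> V. v \<in> es ! i \<inter> es ! j})"
    using sum_indicator_nth[OF vs(1), of "\<lambda>v. v \<in> es ! i \<inter> es ! j"] vs(2) by simp
  also have "{v \<in> V. v \<in> es ! i \<inter> es ! j} = es ! i \<inter> es ! j"
    using edge_subset es assms by fastforce
  finally show ?thesis .
qed

text \<open>Both sides count incident pairs of a vertex in \<open>S\<close> and an edge. Taking
  \<open>S\<close> to be an edge yields degrees of new vertices; \<open>S = V\<close> relates
  \<open>n\<close>, \<open>r\<close> and \<open>m\<close>.\<close>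

lemma double_counting:
  assumes "finite S"
  shows "(\<Sum>f\<in>E. card (S \<inter> f)) = (\<Sum>v\<in>S. vertex_degree E v)"
proof -
  have "(\<Sum>f\<in>E. card (S \<inter> f)) = (\<Sum>f\<in>E. \<Sum>v\<in>S. if v \<in> f then 1 else 0)"
    using assms by (simp add: sum.If_cases)
  also have "\<dots> = (\<Sum>v\<in>S. \<Sum>f\<in>E. if v \<in> f then 1 else 0)"
    by (rule sum.swap)
  also have "\<dots> = (\<Sum>v\<in>S. vertex_degree E v)"
    using finite_E by (simp add: sum.If_cases vertex_degree_def Int_def)
  finally show ?thesis .
qed

text \<open>The neighbours are the endpoints of \<open>e\<close> and the other edges meeting
  \<open>e\<close>. The former contribute \<open>card (e \<inter> e)\<close>, each of the latter
  \<open>card (e \<inter> f) = 1\<close>, so double counting applies to the total.\<close>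

lemma vertex_degree_Q_graph_Inr:
  assumes "e \<in> E"
  shows "vertex_degree (Q_graph_edges E) (Inr e) = (\<Sum>v\<in>e. vertex_degree E v)"
proof -
  let ?N = "{f \<in> E - {e}. e \<inter> f \<noteq> {}}"
  have eq: "{d \<in> Q_graph_edges E. Inr e \<in> d} =
      (\<lambda>v. {Inl v, Inr e}) ` e \<union> (\<lambda>f. {Inr e, Inr f}) ` ?N" (is "?L = ?A \<union> ?B")
  proof
    show "?L \<subseteq> ?A \<union> ?B"
    proof
      fix d assume "d \<in> ?L"
      then consider v where "d = {Inl v, Inr e}" "v \<in> e"
        | f where "d = {Inr e, Inr f}" "f \<in> ?N"
        unfolding Q_graph_edges_def by (auto simp: insert_commute)
      then show "d \<in> ?A \<union> ?B" by cases blast+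
    qed
    show "?A \<union> ?B \<subseteq> ?L"
      using assms by auto
  qed
  have "vertex_degree (Q_graph_edges E) (Inr e) =
      card ((\<lambda>v. {Inl v, Inr e}) ` e) + card ((\<lambda>f. {Inr e, Inr f :: 'a + 'a set}) ` ?N)"
    unfolding vertex_degree_def eq using finite_E finite_edge[OF assms]
    by (intro card_Un_disjoint) (auto simp: doubleton_eq_iff)
  also have "\<dots> = card e + card ?N"
    by (intro arg_cong2[where f = "(+)"] card_image) (auto simp: inj_on_def doubleton_eq_iff)
  also have "card ?N = (\<Sum>f\<in>E - {e}. if e \<inter> f \<noteq> {} then 1 else 0)"
    using finite_E by (simp only: finite_Diff sum.inter_filter[symmetric] card_eq_sum)
  also have "\<dots> = (\<Sum>f\<in>E - {e}. card (e \<inter> f))"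
    by (intro sum.cong refl card_edge_Int[OF assms, symmetric]) auto
  also have "card e + \<dots> = (\<Sum>f\<in>E. card (e \<inter> f))"
    using finite_E assms by (simp add: sum.remove)
  also have "\<dots> = (\<Sum>v\<in>e. vertex_degree E v)"
    using finite_edge[OF assms] by (rule double_counting)
  finally show ?thesis .
qed

text \<open>Original vertices keep degree \<open>r\<close> and are pairwise nonadjacent. New
  vertices have degree \<open>2 * r\<close>; the 2 lost on the diagonal compensates the diagonal of
  \<open>transpose_mat R * R\<close>.\<close>

lemma signless_laplacian_Q_graph:
  assumes "regular_graph V E r"
  shows "signless_laplacian (Q_graph_vertices vs es) (Q_graph_edges E) =
    four_block_mat (real r \<cdot>\<^sub>m 1\<^sub>m n) R (transpose_mat R)
      ((2 * real r - 2) \<cdot>\<^sub>m 1\<^sub>m m + transpose_mat R * R)" (is "?Q = ?B")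
proof (intro eq_matI)
  have dims: "dim_row R = n" "dim_col R = m"
    by (simp_all add: incidence_matrix_def)
  show "dim_row ?Q = dim_row ?B" "dim_col ?Q = dim_col ?B"
    by (simp_all add: signless_laplacian_def adjacency_matrix_def Q_graph_vertices_def dims)
  fix i j assume "i < dim_row ?B" "j < dim_col ?B"
  then have ij: "i < n + m" "j < n + m"
    by (simp_all add: dims)
  let ?ws = "Q_graph_vertices vs es"
  have len: "length ?ws = n + m"
    by (simp add: Q_graph_vertices_def)
  have ws: "?ws ! k = (if k < n then Inl (vs ! k) else Inr (es ! (k - n)))" if "k < n + m" for k
    using that by (auto simp: Q_graph_vertices_def nth_append)
  have Q: "?Q $$ (i, j) = (if i = j then real (vertex_degree (Q_graph_edges E) (?ws ! i)) else 0) +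
      (if {?ws ! i, ?ws ! j} \<in> Q_graph_edges E then 1 else 0)"
    using ij len by (simp add: signless_laplacian_def adjacency_matrix_def degree_matrix_def)
  have deg: "vertex_degree E v = r" if "v \<in> V" for v
    using assms that by (simp add: regular_graph_def)
  have deg_e: "(\<Sum>v\<in>e. vertex_degree E v) = 2 * r" if "e \<in> E" for e
  proof -
    have "(\<Sum>v\<in>e. vertex_degree E v) = (\<Sum>v\<in>e. r)"
      using edge_subset[OF that] deg by (intro sum.cong) auto
    then show ?thesis using card_edge[OF that] by simp
  qed
  have vsV: "vs ! k \<in> V" if "k < n" for k
    using that vs by auto
  have esE: "es ! k \<in> E" if "k < m" for k
    using that es by auto
  consider "i < n" "j < n" | "i < n" "j \<ge> n" | "i \<ge> n" "j < n" | "i \<ge> n" "j \<ge> n"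
    by linarith
  then show "?Q $$ (i, j) = ?B $$ (i, j)"
  proof cases
    case 1
    then show ?thesis
      by (auto simp: Q ws dims vertex_degree_Q_graph_Inl deg vsV)
  next
    case 2
    then show ?thesis
      using ij esE[of "j - n"] by (auto simp: Q ws dims incidence_matrix_def)
  next
    case 3
    then show ?thesis
      using ij esE[of "i - n"] by (auto simp: Q ws dims incidence_matrix_def)
  next
    case 4
    then have e: "es ! (i - n) \<in> E" "es ! (j - n) \<in> E" "i - n < m" "j - n < m"
      using esE[of "i - n"] esE[of "j - n"] ij by auto
    have B: "?B $$ (i, j) = (2 * real r - 2) * (if i = j then 1 else 0) +
        real (card (es ! (i - n) \<inter> es ! (j - n)))"
      using 4 ij e transpose_incidence_mult_index[of "i - n" "j - n"]
      by (auto simp: dims simp del: index_mult_mat(1))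
    show ?thesis
    proof (cases "i = j")
      case True
      then show ?thesis
        unfolding B Q using 4 ij e by (simp add: ws vertex_degree_Q_graph_Inr deg_e card_edge)
    next
      case False
      then have "es ! (i - n) \<noteq> es ! (j - n)"
        using 4 e es by (simp add: nth_eq_iff_index_eq)
      then show ?thesis
        unfolding B Q using False 4 ij e by (simp add: ws card_edge_Int)
    qed
  qed
qed

lemma regular_graph_card:
  assumes "regular_graph V E r"
  shows "n * r = 2 * m"
proof -
  have "2 * m = (\<Sum>f\<in>E. card (V \<inter> f))"
    using es distinct_card[OF es(1)] edge_subset card_edge
    by (simp add: Int_absorb1)
  also have "\<dots> = (\<Sum>v\<in>V. r)"
    using assms finite_V by (simp add: double_counting regular_graph_def)
  also have "\<dots> = n * r"
    using vs distinct_card[OF vs(1)] by simp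
  finally show ?thesis by simp
qed

text \<open>A vector in the kernel of the transposed incidence matrix changes sign along every edge, so by
  connectedness it vanishes nowhere and its sign pattern is a bipartition.\<close>

lemma transpose_incidence_kernel_imp_bipartite:
  assumes conn: "connected_graph V E"
    and x: "x \<in> carrier_vec n" "x \<noteq> 0\<^sub>v n" "transpose_mat R *\<^sub>v x = 0\<^sub>v m"
  shows "bipartite_graph V E"
proof -
  have bij: "bij_betw (nth vs) {0..<n} V"
    using vs by (intro bij_betw_nth) (auto simp: lessThan_atLeast0)
  \<comment> \<open>The coordinates of \<open>x\<close> become a function on vertices, independent
    of positions in \<open>vs\<close>.\<close>
  define f where "f v = x $ inv_into {0..<n} (nth vs) v" for v
  have f: "f (vs ! k) = x $ k" if "k < n" for k
    using bij that by (simp add: f_def bij_betw_def)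
  have opp: "f v = - f u" if edge: "{u, v} \<in> E" for u v
  proof -
    obtain j where j: "j < m" "es ! j = {u, v}"
      using edge es(2) by (metis in_set_conv_nth)
    have uv: "u \<noteq> v" "{u, v} \<subseteq> V"
      using card_edge[OF edge] edge_subset[OF edge] by (cases "u = v"; simp)+
    have "0 = (transpose_mat R *\<^sub>v x) $ j"
      using x(3) j by simp
    also have "\<dots> = (\<Sum>k\<in>{0..<n}. if vs ! k \<in> {u, v} then f (vs ! k) else 0)"
      using j x(1) by (auto simp: incidence_matrix_def scalar_prod_def f intro!: sum.cong)
    also have "\<dots> = (\<Sum>w\<in>V. if w \<in> {u, v} then f w else 0)"
      by (rule sum.reindex_bij_betw[OF bij])
    also have "\<dots> = (\<Sum>w\<in>{u, v}. f w)"
      using uv(2) by (intro sum.mono_neutral_cong_right finite_V) auto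
    also have "\<dots> = f u + f v"
      using uv(1) by simp
    finally show ?thesis by simp
  qed
  have const: "\<bar>f v\<bar> = \<bar>f u\<bar>" if "(u, v) \<in> {(a, b). {a, b} \<in> E}\<^sup>*" for u v
    using that by (induction rule: rtrancl_induct) (auto dest!: opp)
  obtain k where k: "k < n" "x $ k \<noteq> 0"
    using x(1,2) by (metis carrier_vecD eq_vecI index_zero_vec)
  then have "vs ! k \<in> V" "f (vs ! k) \<noteq> 0"
    using vs f by auto
  then have nz: "f v \<noteq> 0" if "v \<in> V" for v
    using const[of "vs ! k" v] conn that by (auto simp: connected_graph_def)
  let ?A = "{v \<in> V. f v > 0}" and ?B = "{v \<in> V. \<not> f v > 0}"
  have "\<exists>a\<in>?A. \<exists>b\<in>?B. e = {a, b}" if "e \<in> E" for e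
  proof -
    obtain u v where uv: "u \<in> V" "v \<in> V" "e = {u, v}"
      using \<open>e \<in> E\<close> by (rule edgeE)
    have "f v = - f u" "f u \<noteq> 0"
      using opp[of u v] nz[OF uv(1)] uv(3) \<open>e \<in> E\<close> by simp_all
    then have "u \<in> ?A \<and> v \<in> ?B \<or> v \<in> ?A \<and> u \<in> ?B"
      using uv(1,2) by (cases "f u > 0") simp_all
    then show ?thesis
      unfolding uv(3) using insert_commute[of u v "{}"] by blast
  qed
  then show ?thesis
    unfolding bipartite_graph_def by (intro exI[of _ ?A] exI[of _ ?B]) auto
qed

text \<open>Follows from \<open>incidence_mult_transpose\<close>. It evaluates the squared norm of
  \<open>transpose_mat R *\<^sub>v x\<close> and carries orthogonality of eigenvectors over to the
  edge block.\<close>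

lemma scalar_prod_transpose_incidence:
  assumes "x \<in> carrier_vec n" "w \<in> carrier_vec n"
  shows "(transpose_mat R *\<^sub>v x) \<bullet> (transpose_mat R *\<^sub>v w) = x \<bullet> (signless_laplacian vs E *\<^sub>v w)"
proof -
  have "(transpose_mat R *\<^sub>v x) \<bullet> (transpose_mat R *\<^sub>v w) = x \<bullet> (R *\<^sub>v (transpose_mat R *\<^sub>v w))"
    using assms by (intro transpose_vec_mult_scalar[OF incidence_carrier]) simp_all
  also have "R *\<^sub>v (transpose_mat R *\<^sub>v w) = signless_laplacian vs E *\<^sub>v w"
    unfolding incidence_mult_transpose[symmetric]
    using assms by (intro assoc_mult_mat_vec[of _ n m _ n, symmetric]) simp_all
  finally show ?thesis .
qed

text \<open>Here \<open>q * (x \<bullet> x)\<close> is the squared norm of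
  \<open>transpose_mat R *\<^sub>v x\<close>, which by the kernel lemma is nonzero.\<close>

lemma signless_laplacian_eigenvalue_pos:
  assumes "connected_graph V E" "\<not> bipartite_graph V E"
    and x: "eigenvector (signless_laplacian vs E) x q"
  shows "q > 0"
proof -
  let ?z = "transpose_mat R *\<^sub>v x"
  have xc: "x \<in> carrier_vec n" "x \<noteq> 0\<^sub>v n" "signless_laplacian vs E *\<^sub>v x = q \<cdot>\<^sub>v x"
    using x by (simp_all add: eigenvector_def carrier_matD(1)[OF signless_laplacian_carrier])
  have zc: "?z \<in> carrier_vec m"
    by simp
  have "?z \<noteq> 0\<^sub>v m"
    using transpose_incidence_kernel_imp_bipartite assms(1,2) xc by blast
  then have "?z \<bullet> ?z \<noteq> 0"
    using real_scalar_prod_self_eq_0_iff[OF zc] by simp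
  moreover have nonneg: "v \<bullet> v \<ge> 0" for v :: "real vec"
    by (simp add: scalar_prod_def sum_nonneg)
  ultimately have "?z \<bullet> ?z > 0"
    by (simp add: less_le)
  then have "q * (x \<bullet> x) > 0"
    using xc scalar_prod_transpose_incidence[OF xc(1,1)] by simp
  then show ?thesis
    using nonneg[of x] by (simp add: zero_less_mult_iff)
qed

end

section \<open>Eigenvalues and eigenvectors of the \<open>\<Q>\<close>-graph\<close>

lemma eigenvector_smult:
  fixes A :: "real mat"
  assumes "A \<in> carrier_mat k k" "eigenvector A v ev" "c \<noteq> 0"
  shows "eigenvector A (c \<cdot>\<^sub>v v) ev"
proof -
  have v: "v \<in> carrier_vec k" "v \<noteq> 0\<^sub>v k" "A *\<^sub>v v = ev \<cdot>\<^sub>v v"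
    using assms(1,2) by (auto simp: eigenvector_def)
  then obtain i where "i < k" "v $ i \<noteq> 0"
    by (metis carrier_vecD eq_vecI index_zero_vec)
  then have "(c \<cdot>\<^sub>v v) $ i \<noteq> 0\<^sub>v k $ i"
    using v \<open>c \<noteq> 0\<close> by simp
  then have "c \<cdot>\<^sub>v v \<noteq> 0\<^sub>v k"
    by metis
  then show ?thesis
    using assms(1) v by (simp add: eigenvector_def mult_mat_vec smult_smult_assoc mult.commute)
qed

text \<open>The number \<open>a\<close> is the coefficient of the vertex block in
  \<open>X_vec\<close>. With \<open>p = q + r - 2\<close>, the quadratic formula for
  \<open>a * a + p * a - q = 0\<close> reads \<open>2 * a = s * t - p\<close>.\<close>

lemma q_pm_shift:
  fixes r :: nat
  assumes "q > 0" "s \<in> {1, -1}"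
  defines "a \<equiv> q_pm r s q + 2 - 2 * real r - q"
  shows "a * a = q - (q + real r - 2) * a"
proof -
  define p where "p = q + real r - 2"
  define t where "t = sqrt (p\<^sup>2 + 4 * q)"
  have t: "t * t = p * p + 4 * q"
    using assms(1) by (simp add: t_def power2_eq_square)
  have s: "s * s = 1"
    using assms(2) by auto
  have a: "2 * a = s * t - p"
    by (simp add: a_def q_pm_def t_def p_def field_simps)
  have "4 * (a * a) = (s * t - p) * (s * t - p)"
    by (simp flip: a)
  also have "\<dots> = (s * s) * (t * t) - 2 * p * (s * t) + p * p"
    by (simp add: algebra_simps)
  also have "\<dots> = 4 * q - 2 * p * (s * t - p)"
    by (simp add: s t algebra_simps)
  also have "\<dots> = 4 * (q - p * a)"
    by (simp flip: a)
  finally show ?thesis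
    by (simp add: p_def)
qed

text \<open>Expressing \<open>a\<close> through \<open>q_pm\<close> cancels the terms quadratic in
  \<open>q\<close>. The resulting relation is linear in \<open>q\<close>, so \<open>q\<close> can be
  recovered from \<open>q_pm\<close>.\<close>

lemma q_pm_root:
  assumes "q > 0" "s \<in> {1, -1}"
  shows "(q_pm r s q - real r) * (q_pm r s q - 2 * real r + 2) = q * (1 + q_pm r s q - real r)"
  using q_pm_shift[OF assms, of r] by (simp add: algebra_simps)

lemma q_pm_neq:
  assumes "q > 0" "s \<in> {1, -1}" "r \<ge> 2"
  shows "q_pm r s q \<noteq> 2 * real r - 2"
proof
  assume eq: "q_pm r s q = 2 * real r - 2"
  \<comment> \<open>At \<open>2 * r - 2\<close> the left side of \<open>q_pm_root\<close>
    vanishes.\<close>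
  have "q * (real r - 1) = 0"
    using q_pm_root[OF assms(1,2), of r] unfolding eq by (simp add: algebra_simps)
  then show False
    using assms by simp
qed

lemma q_pm_inject:
  assumes "q > 0" "s \<in> {1, -1}" "q' > 0" "s' \<in> {1, -1}" "r \<ge> 2"
    and eq: "q_pm r s q = q_pm r s' q'"
  shows "q = q' \<and> s = s'"
proof -
  define c where "c = q_pm r s q"
  have roots: "(c - real r) * (c - 2 * real r + 2) = q * (1 + c - real r)"
    "(c - real r) * (c - 2 * real r + 2) = q' * (1 + c - real r)"
    using q_pm_root[OF assms(1,2), of r] q_pm_root[OF assms(3,4), of r] by (simp_all add: c_def eq)
  \<comment> \<open>For \<open>c = r - 1\<close> the relation would read
    \<open>r - 1 = 0\<close>.\<close>
  have "1 + c - real r \<noteq> 0"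
  proof
    assume "1 + c - real r = 0"
    then have "c = real r - 1" by simp
    then show False
      using roots(1) \<open>r \<ge> 2\<close> by simp
  qed
  then have q: "q = q'"
    using roots by simp
  \<comment> \<open>For equal \<open>q\<close> only the sign before the root can differ, and a
    nonzero root separates the signs.\<close>
  have "sqrt ((q + real r - 2)\<^sup>2 + 4 * q) > 0"
    using assms(1) by (simp add: add_nonneg_pos)
  then have "s = s'"
    using eq q by (simp add: q_pm_def)
  with q show ?thesis by simp
qed

section \<open>Eigenvectors of the block matrix and their orthogonality\<close>

context enumerated_graph
begin

abbreviation "QL \<equiv> signless_laplacian (Q_graph_vertices vs es) (Q_graph_edges E)"

lemma QL_carrier [simp]: "QL \<in> carrier_mat (n + m) (n + m)"
  using signless_laplacian_carrier[of "Q_graph_vertices vs es"] by (simp add: Q_graph_vertices_def)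

text \<open>Applying \<open>transpose_mat R * R\<close> in two stages lets
  \<open>R *\<^sub>v b\<close> be replaced by its value: zero on the kernel,
  \<open>q \<cdot>\<^sub>v x\<close> for lifted eigenvectors.\<close>

lemma QL_mult_append:
  assumes "regular_graph V E r" and ab: "a \<in> carrier_vec n" "b \<in> carrier_vec m"
  shows "QL *\<^sub>v (a @\<^sub>v b) = (real r \<cdot>\<^sub>v a + R *\<^sub>v b) @\<^sub>v
    (transpose_mat R *\<^sub>v a + ((2 * real r - 2) \<cdot>\<^sub>v b + transpose_mat R *\<^sub>v (R *\<^sub>v b)))"
proof -
  have smult_one: "(c \<cdot>\<^sub>m 1\<^sub>m k) *\<^sub>v v = c \<cdot>\<^sub>v v" if "v \<in> carrier_vec k" for c k and v :: "real vec"
    using that by (intro eq_vecI) auto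
  have "(transpose_mat R * R) *\<^sub>v b = transpose_mat R *\<^sub>v (R *\<^sub>v b)"
    using ab by (intro assoc_mult_mat_vec[of _ m n _ m]) simp_all
  moreover have "((2 * real r - 2) \<cdot>\<^sub>m 1\<^sub>m m + transpose_mat R * R) *\<^sub>v b =
      ((2 * real r - 2) \<cdot>\<^sub>m 1\<^sub>m m) *\<^sub>v b + (transpose_mat R * R) *\<^sub>v b"
    using ab by (intro add_mult_distrib_mat_vec[of _ m m] mult_carrier_mat[of _ m n]) simp_all
  ultimately show ?thesis
    unfolding signless_laplacian_Q_graph[OF assms(1)] using ab
    by (subst four_block_mat_mult_vec[of _ n n _ m _ m])
      (simp_all add: smult_one mult_carrier_mat[of _ m n])
qed

lemma eigenvector_QL_kernel:
  assumes "regular_graph V E r"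
    and y: "y \<in> carrier_vec m" "y \<noteq> 0\<^sub>v m" "R *\<^sub>v y = 0\<^sub>v n"
  shows "eigenvector QL (0\<^sub>v n @\<^sub>v y) (2 * real r - 2)"
proof -
  have RT0: "transpose_mat R *\<^sub>v 0\<^sub>v n = 0\<^sub>v m"
    by (intro eq_vecI) (auto simp: incidence_matrix_def scalar_prod_def)
  have "0\<^sub>v (n + m) = 0\<^sub>v n @\<^sub>v (0\<^sub>v m :: real vec)"
    by (intro eq_vecI) auto
  then have "0\<^sub>v n @\<^sub>v y \<noteq> 0\<^sub>v (n + m)"
    using y append_vec_eq[of "0\<^sub>v n" n "0\<^sub>v n" y "0\<^sub>v m"] by simp
  moreover have "QL *\<^sub>v (0\<^sub>v n @\<^sub>v y) = (2 * real r - 2) \<cdot>\<^sub>v (0\<^sub>v n @\<^sub>v y)"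
    unfolding QL_mult_append[OF assms(1) zero_carrier_vec y(1)] y(3) RT0
    using y(1) by (intro eq_vecI) auto
  ultimately show ?thesis
    using y(1) by (simp add: eigenvector_def carrier_matD(1)[OF QL_carrier])
qed

text \<open>The edge block is scaled by \<open>a + 2 * r - 2 + q\<close>. The vertex block is scaled
  alike exactly when \<open>r * a + q = (a + 2 * r - 2 + q) * a\<close>, which is the quadratic
  hypothesis.\<close>

lemma eigenvector_QL_lift:
  assumes "regular_graph V E r"
    and x: "eigenvector (signless_laplacian vs E) x q"
    and a: "a \<noteq> 0" "a * a = q - (q + real r - 2) * a"
  shows "eigenvector QL ((a \<cdot>\<^sub>v x) @\<^sub>v (transpose_mat R *\<^sub>v x)) (a + 2 * real r - 2 + q)"
proof -
  let ?z = "transpose_mat R *\<^sub>v x" and ?c = "a + 2 * real r - 2 + q"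
  have xc: "x \<in> carrier_vec n" "x \<noteq> 0\<^sub>v n" "signless_laplacian vs E *\<^sub>v x = q \<cdot>\<^sub>v x"
    using x by (simp_all add: eigenvector_def carrier_matD(1)[OF signless_laplacian_carrier])
  have Rz: "R *\<^sub>v ?z = q \<cdot>\<^sub>v x"
    using xc assoc_mult_mat_vec[of R n m "transpose_mat R" n x]
    by (simp add: incidence_mult_transpose)
  have RT: "transpose_mat R *\<^sub>v (c \<cdot>\<^sub>v x) = c \<cdot>\<^sub>v ?z" for c
    using xc(1) by (intro mult_mat_vec[of _ m n]) simp_all
  \<comment> \<open>Since \<open>a\<close> is nonzero, the vertex block alone shows that the lifted
    vector is nonzero.\<close>
  obtain k where "k < n" "x $ k \<noteq> 0"
    using xc by (metis carrier_vecD eq_vecI index_zero_vec)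
  then have "((a \<cdot>\<^sub>v x) @\<^sub>v ?z) $ k \<noteq> 0\<^sub>v (n + m) $ k"
    using a(1) xc(1) by simp
  then have nz: "(a \<cdot>\<^sub>v x) @\<^sub>v ?z \<noteq> 0\<^sub>v (n + m)"
    by metis
  have eq1: "real r * (a * u) + q * u = ?c * (a * u)" for u
  proof -
    have "real r * a + q = ?c * a"
      using a(2) by (simp add: algebra_simps)
    then show ?thesis
      by (metis distrib_right mult.assoc)
  qed
  have combine: "(real r \<cdot>\<^sub>v (a \<cdot>\<^sub>v x) + q \<cdot>\<^sub>v x) @\<^sub>v
      (a \<cdot>\<^sub>v z + ((2 * real r - 2) \<cdot>\<^sub>v z + q \<cdot>\<^sub>v z)) = ?c \<cdot>\<^sub>v ((a \<cdot>\<^sub>v x) @\<^sub>v z)"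
    if "z \<in> carrier_vec m" for z
  proof (intro eq_vecI)
    fix i assume "i < dim_vec (?c \<cdot>\<^sub>v ((a \<cdot>\<^sub>v x) @\<^sub>v z))"
    then have "i < n + m" using that xc(1) by simp
    then show "((real r \<cdot>\<^sub>v (a \<cdot>\<^sub>v x) + q \<cdot>\<^sub>v x) @\<^sub>v
        (a \<cdot>\<^sub>v z + ((2 * real r - 2) \<cdot>\<^sub>v z + q \<cdot>\<^sub>v z))) $ i = (?c \<cdot>\<^sub>v ((a \<cdot>\<^sub>v x) @\<^sub>v z)) $ i"
      using carrier_vecD[OF xc(1)] carrier_vecD[OF that] eq1[of "x $ i"]
      by (cases "i < n") (simp, simp add: algebra_simps)
  qed (use xc(1) that in simp)
  have "QL *\<^sub>v ((a \<cdot>\<^sub>v x) @\<^sub>v ?z) = (real r \<cdot>\<^sub>v (a \<cdot>\<^sub>v x) + q \<cdot>\<^sub>v x) @\<^sub>v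
      (a \<cdot>\<^sub>v ?z + ((2 * real r - 2) \<cdot>\<^sub>v ?z + q \<cdot>\<^sub>v ?z))"
    using xc(1) QL_mult_append[OF assms(1), of "a \<cdot>\<^sub>v x" ?z] by (simp add: Rz RT)
  also have "\<dots> = ?c \<cdot>\<^sub>v ((a \<cdot>\<^sub>v x) @\<^sub>v ?z)"
    by (rule combine) simp
  finally show ?thesis
    using nz xc(1) by (simp add: eigenvector_def carrier_matD(1)[OF QL_carrier])
qed

lemma eigenvector_X_vec:
  assumes "regular_graph V E r" "q > 0" "s \<in> {1, -1}"
    and x: "eigenvector (signless_laplacian vs E) x q"
  shows "eigenvector QL (X_vec R r s q x) (q_pm r s q)"
proof -
  let ?a = "q_pm r s q + 2 - 2 * real r - q"
  have sq: "?a * ?a = q - (q + real r - 2) * ?a"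
    by (rule q_pm_shift[OF assms(2,3)])
  \<comment> \<open>A zero coefficient would reduce the quadratic to \<open>q = 0\<close>.\<close>
  then have "?a \<noteq> 0"
    using assms(2) by auto
  then have "eigenvector QL ((?a \<cdot>\<^sub>v x) @\<^sub>v (transpose_mat R *\<^sub>v x)) (?a + 2 * real r - 2 + q)"
    using eigenvector_QL_lift[OF assms(1) x] sq by blast
  moreover have "1 / sqrt (?a\<^sup>2 + q) \<noteq> 0"
    using assms(2) by (simp add: add_nonneg_eq_0_iff)
  ultimately have "eigenvector QL (X_vec R r s q x) (?a + 2 * real r - 2 + q)"
    unfolding X_vec_def by (intro eigenvector_smult[OF QL_carrier])
  then show ?thesis by simp
qed

lemma eigenvector_Y_vec:
  assumes "regular_graph V E r" "y \<in> carrier_vec m" "y \<bullet> y = 1" "R *\<^sub>v y = 0\<^sub>v n"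
  shows "eigenvector QL (Y_vec n y) (2 * real r - 2)"
proof -
  have "y \<noteq> 0\<^sub>v m"
    using assms(3) real_scalar_prod_self_eq_0_iff[OF assms(2)] by auto
  then show ?thesis
    unfolding Y_vec_def using assms eigenvector_QL_kernel
    by (intro eigenvector_smult[OF QL_carrier]) (simp_all add: vec_norm2_def)
qed

text \<open>The eigenvalues coincide here, so the blocks are compared directly: both contribute
  multiples of \<open>x \<bullet> x'\<close>.\<close>

lemma X_vec_orthogonal_same:
  assumes "eigenvector (signless_laplacian vs E) x q" "eigenvector (signless_laplacian vs E) x' q"
    and "x \<bullet> x' = 0"
  shows "X_vec R r s q x \<bullet> X_vec R r s q x' = 0"
proof -
  have xc: "x \<in> carrier_vec n" "x' \<in> carrier_vec n" "signless_laplacian vs E *\<^sub>v x' = q \<cdot>\<^sub>v x'"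
    using assms(1,2) by (simp_all add: eigenvector_def carrier_matD(1)[OF signless_laplacian_carrier])
  have "(transpose_mat R *\<^sub>v x) \<bullet> (transpose_mat R *\<^sub>v x') = 0"
    using xc assms(3) by (simp add: scalar_prod_transpose_incidence)
  moreover have "((a \<cdot>\<^sub>v x) @\<^sub>v (transpose_mat R *\<^sub>v x)) \<bullet> ((a \<cdot>\<^sub>v x') @\<^sub>v (transpose_mat R *\<^sub>v x')) =
      (a \<cdot>\<^sub>v x) \<bullet> (a \<cdot>\<^sub>v x') + (transpose_mat R *\<^sub>v x) \<bullet> (transpose_mat R *\<^sub>v x')" for a
    using xc(1,2) by (intro scalar_prod_append[of _ n _ m]) simp_all
  ultimately show ?thesis
    unfolding X_vec_def using carrier_vecD[OF xc(1)] carrier_vecD[OF xc(2)] assms(3) by simp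
qed

lemma Y_vec_orthogonal:
  assumes "y \<in> carrier_vec m" "y' \<in> carrier_vec m" "y \<bullet> y' = 0"
  shows "Y_vec n y \<bullet> Y_vec n y' = 0"
  using assms scalar_prod_append[of "0\<^sub>v n" n y m "0\<^sub>v n" y']
  by (simp add: Y_vec_def)

end

section \<open>Multiplicities and the complete spectrum\<close>

lemma sum_single_mset_const: "(\<Sum>x\<in>A. {#c#}) = replicate_mset (card A) c"
  by (induction A rule: infinite_finite_induct) simp_all

text \<open>The \<open>l i\<close> are root multiplicities; they exhaust the degree because the
  characteristic polynomial splits over the reals.\<close>

lemma sum_multiplicities:
  assumes inj: "inj_on q {0..d}"
    and spec: "spectrum (signless_laplacian vs E) = q ` {0..d}"
    and l: "\<And>i. i \<le> d \<Longrightarrow> l i = count (signless_laplacian_spectrum vs E) (q i)"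
  shows "(\<Sum>i\<in>{0..d}. l i) = length vs"
proof -
  let ?p = "char_poly (signless_laplacian vs E)"
  have "?p \<noteq> 0"
    using degree_monic_char_poly[OF signless_laplacian_carrier, of vs E] by auto
  then have set: "set_mset (proots ?p) = q ` {0..d}"
    unfolding spec[symmetric] spectrum_def
    by (auto simp: eigenvalue_root_char_poly[OF signless_laplacian_carrier])
  have "length vs = size (proots ?p)"
    by (rule size_proots_char_poly_symmetric[symmetric]) simp_all
  also have "\<dots> = (\<Sum>c\<in>q ` {0..d}. count (proots ?p) c)"
    by (simp only: size_multiset_overloaded_eq set)
  also have "\<dots> = (\<Sum>i\<in>{0..d}. l i)"
    using l by (simp add: sum.reindex[OF inj] signless_laplacian_spectrum_def)
  finally show ?thesis by simp
qed

theorem theorem3p1: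
  fixes V :: "'a set" and E :: "'a set set"
    and vs :: "'a list" and es :: "'a set list"
    and n m r d :: nat
    and q :: "nat \<Rightarrow> real" and l :: "nat \<Rightarrow> nat"
    and x :: "nat \<Rightarrow> nat \<Rightarrow> real vec" and y :: "nat \<Rightarrow> real vec"
  assumes "simple_graph V E"
    and "regular_graph V E r" and "r \<ge> 2"
    and "connected_graph V E"
    and "\<not> bipartite_graph V E"
    and "distinct vs" and "set vs = V" and "length vs = n"
    and "distinct es" and "set es = E" and "length es = m"
    and "q 0 = 2 * real r"
    and "\<And>i j. i < j \<Longrightarrow> j \<le> d \<Longrightarrow> q j < q i"
    and "spectrum (signless_laplacian vs E) = q ` {0..d}"
    and "\<And>i. i \<le> d \<Longrightarrow> l i = count (signless_laplacian_spectrum vs E) (q i)"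
    and "\<And>i j. i \<le> d \<Longrightarrow> j \<in> {1..l i} \<Longrightarrow> eigenvector (signless_laplacian vs E) (x i j) (q i)"
    and "\<And>i j k. i \<le> d \<Longrightarrow> j \<in> {1..l i} \<Longrightarrow> k \<in> {1..l i} \<Longrightarrow>
           x i j \<bullet> x i k = (if j = k then 1 else 0)"
    and "\<And>k. k \<in> {1..m - n} \<Longrightarrow> y k \<in> carrier_vec m"
    and "\<And>k. k \<in> {1..m - n} \<Longrightarrow> incidence_matrix vs es *\<^sub>v y k = 0\<^sub>v n"
    and "\<And>j k. j \<in> {1..m - n} \<Longrightarrow> k \<in> {1..m - n} \<Longrightarrow>
           y j \<bullet> y k = (if j = k then 1 else 0)"
  shows
    "signless_laplacian_spectrum (Q_graph_vertices vs es) (Q_graph_edges E) =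
       replicate_mset (m - n) (2 * real r - 2) +
       (\<Sum>i\<in>{0..d}. replicate_mset (l i) (q_pm r 1 (q i)) + replicate_mset (l i) (q_pm r (-1) (q i)))
     \<and> count (signless_laplacian_spectrum (Q_graph_vertices vs es) (Q_graph_edges E))
         (2 * real r - 2) = m - n
     \<and> (\<forall>i\<le>d. \<forall>s\<in>{1, -1}.
         count (signless_laplacian_spectrum (Q_graph_vertices vs es) (Q_graph_edges E))
           (q_pm r s (q i)) = l i)
     \<and> (\<forall>k\<in>{1..m - n}.
         eigenvector (signless_laplacian (Q_graph_vertices vs es) (Q_graph_edges E))
           (Y_vec n (y k)) (2 * real r - 2))
     \<and> (\<forall>i\<le>d. \<forall>s\<in>{1, -1}. \<forall>j\<in>{1..l i}.
         eigenvector (signless_laplacian (Q_graph_vertices vs es) (Q_graph_edges E))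
           (X_vec (incidence_matrix vs es) r s (q i) (x i j)) (q_pm r s (q i)))
     \<and> (\<forall>k\<in>{1..m - n}. \<forall>k'\<in>{1..m - n}. k \<noteq> k' \<longrightarrow> Y_vec n (y k) \<bullet> Y_vec n (y k') = 0)
     \<and> (\<forall>k\<in>{1..m - n}. \<forall>i\<le>d. \<forall>s\<in>{1, -1}. \<forall>j\<in>{1..l i}.
         Y_vec n (y k) \<bullet> X_vec (incidence_matrix vs es) r s (q i) (x i j) = 0)
     \<and> (\<forall>i\<le>d. \<forall>s\<in>{1, -1}. \<forall>j\<in>{1..l i}. \<forall>i'\<le>d. \<forall>s'\<in>{1, -1}. \<forall>j'\<in>{1..l i'}.
         (i, s, j) \<noteq> (i', s', j') \<longrightarrow>
         X_vec (incidence_matrix vs es) r s (q i) (x i j) \<bullet>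
         X_vec (incidence_matrix vs es) r s' (q i') (x i' j') = 0)"
proof -
  interpret G: enumerated_graph V E vs es
    using assms by unfold_locales simp_all
  note reg = \<open>regular_graph V E r\<close>
  note r = \<open>r \<ge> 2\<close>
  note n = \<open>length vs = n\<close> and m = \<open>length es = m\<close>
  note spec = \<open>spectrum (signless_laplacian vs E) = q ` {0..d}\<close>
  let ?Q = "signless_laplacian (Q_graph_vertices vs es) (Q_graph_edges E)"
  let ?spec = "signless_laplacian_spectrum (Q_graph_vertices vs es) (Q_graph_edges E)"
  let ?R = "incidence_matrix vs es"
  let ?X = "\<lambda>(i, s, j). X_vec ?R r s (q i) (x i j)"
  let ?Y = "\<lambda>k. Y_vec n (y k)"
  have q_inj: "q i = q j \<longleftrightarrow> i = j" if "i \<le> d" "j \<le> d" for i j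
    using assms(13)[of i j] assms(13)[of j i] that by (cases i j rule: linorder_cases) auto
  have q_pos: "q i > 0" if "i \<le> d" for i
  proof -
    have "eigenvalue (signless_laplacian vs E) (q i)"
      using spec that by (auto simp: spectrum_def)
    then show ?thesis
      using G.signless_laplacian_eigenvalue_pos assms(4,5) unfolding eigenvalue_def by blast
  qed
  have X_eigen: "eigenvector ?Q (?X (i, s, j)) (q_pm r s (q i))"
    if "i \<le> d" "s \<in> {1, -1}" "j \<in> {1..l i}" for i s j
    using G.eigenvector_X_vec[OF reg q_pos[OF that(1)] that(2) assms(16)[OF that(1,3)]] by simp
  have Y_eigen: "eigenvector ?Q (?Y k) (2 * real r - 2)" if "k \<in> {1..m - n}" for k
    using G.eigenvector_Y_vec[OF reg] assms(18,19,20) that n m by simp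
  have YY: "?Y k \<bullet> ?Y k' = 0" if "k \<in> {1..m - n}" "k' \<in> {1..m - n}" "k \<noteq> k'" for k k'
    using G.Y_vec_orthogonal assms(18,20) that n m by simp
  have YX: "?Y k \<bullet> ?X (i, s, j) = 0"
    if "k \<in> {1..m - n}" "i \<le> d" "s \<in> {1, -1}" "j \<in> {1..l i}" for k i s j
    using symmetric_eigenvectors_orthogonal[OF G.QL_carrier signless_laplacian_symmetric
        Y_eigen[OF that(1)] X_eigen[OF that(2-4)]] q_pm_neq[OF q_pos[OF that(2)] that(3) r] by simp
  have XX: "?X (i, s, j) \<bullet> ?X (i', s', j') = 0"
    if "i \<le> d" "s \<in> {1, -1}" "j \<in> {1..l i}" "i' \<le> d" "s' \<in> {1, -1}" "j' \<in> {1..l i'}"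
      "(i, s, j) \<noteq> (i', s', j')" for i s j i' s' j'
  \<comment> \<open>Same index and sign: orthogonality comes from the \<open>x i j\<close>.
    Otherwise the eigenvalues differ.\<close>
  proof (cases "i = i' \<and> s = s'")
    case True
    then show ?thesis
      using G.X_vec_orthogonal_same assms(16,17) that by simp
  next
    case False
    then have "q_pm r s (q i) \<noteq> q_pm r s' (q i')"
      using q_pm_inject[OF q_pos[OF that(1)] that(2) q_pos[OF that(4)] that(5) r] q_inj that by blast
    then show ?thesis
      using symmetric_eigenvectors_orthogonal[OF G.QL_carrier signless_laplacian_symmetric
          X_eigen[OF that(1-3)] X_eigen[OF that(4-6)]] by blast
  qed
  have "inj_on q {0..d}"
    using q_inj by (auto simp: inj_on_def)
  then have sum_l: "(\<Sum>i\<in>{0..d}. l i) = n"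
    using sum_multiplicities[of q d vs E l] spec assms(15) n by blast
  \<comment> \<open>With \<open>n * r = 2 * m\<close> this gives \<open>n \<le> m\<close>, so the
    subtraction \<open>m - n\<close> on naturals is not truncated.\<close>
  have "n * 2 \<le> n * r"
    using r by simp
  then have "n \<le> m"
    using G.regular_graph_card[OF reg] unfolding n m by linarith
  \<comment> \<open>The vectors \<open>X\<close> are indexed by eigenvalue, sign and position;
    \<open>?I\<close> adds the indices of the \<open>Y\<close> as a disjoint summand.\<close>
  let ?J = "SIGMA i:{0..d}. {1, -1 :: real} \<times> {1..l i}"
  let ?I = "{1..m - n} <+> ?J"
  let ?v = "case_sum ?Y ?X"
  let ?ev = "case_sum (\<lambda>k. 2 * real r - 2) (\<lambda>(i, s, j). q_pm r s (q i))"
  have "card ?J = 2 * n"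
    by (simp add: sum_l)
  then have card_I: "card ?I = n + m"
    using \<open>n \<le> m\<close> by (simp add: card_Plus del: card_SigmaI)
  \<comment> \<open>There are as many vectors as the order \<open>n + m\<close> of the matrix, so no
    further eigenvalue is possible.\<close>
  have "char_poly ?Q = (\<Prod>z\<in>?I. [:- ?ev z, 1:])"
  proof (rule char_poly_orthogonal_eigenvectors)
    show "?Q \<in> carrier_mat (n + m) (n + m)"
      using G.QL_carrier n m by simp
    show "eigenvector ?Q (?v z) (?ev z)" if "z \<in> ?I" for z
      using that X_eigen Y_eigen by auto
    show "?v z \<bullet> ?v w = 0" if zw: "z \<in> ?I" "w \<in> ?I" "z \<noteq> w" for z w
    proof -
      consider k k' where "z = Inl k" "w = Inl k'"
        | k i s j where "z = Inl k" "w = Inr (i, s, j)"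
        | k i s j where "z = Inr (i, s, j)" "w = Inl k"
        | i s j i' s' j' where "z = Inr (i, s, j)" "w = Inr (i', s', j')"
        by (metis prod_cases3 sum.exhaust)
      then show ?thesis
      proof cases
        case 1
        then show ?thesis using zw YY[of k k'] by auto
      next
        case 2
        then show ?thesis using zw YX[of k i s j] by auto
      next
        case 3
        then have "?Y k \<bullet> ?X (i, s, j) = 0"
          using zw YX[of k i s j] by auto
        moreover have "?X (i, s, j) \<in> carrier_vec (n + m)" "?Y k \<in> carrier_vec (n + m)"
          using zw 3 X_eigen[of i s j] Y_eigen[of k] carrier_matD(1)[OF G.QL_carrier] n m
          by (auto simp: eigenvector_def)
        ultimately show ?thesis
          using 3 comm_scalar_prod by fastforce
      next
        case 4
        then show ?thesis using zw XX[of i s j i' s' j'] by auto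
      qed
    qed
  qed (use card_I in auto)
  then have "?spec = (\<Sum>z\<in>?I. {#?ev z#})"
    by (simp add: signless_laplacian_spectrum_def proots_prod)
  also have "\<dots> = (\<Sum>k\<in>{1..m - n}. {#2 * real r - 2#}) + (\<Sum>(i, s, j)\<in>?J. {#q_pm r s (q i)#})"
    by (subst sum.Plus) (auto simp: case_prod_unfold)
  also have "(\<Sum>(i, s, j)\<in>?J. {#q_pm r s (q i)#}) =
      (\<Sum>i\<in>{0..d}. \<Sum>(s, j)\<in>{1, -1} \<times> {1..l i}. {#q_pm r s (q i)#})"
    by (subst sum.Sigma) (auto simp: case_prod_unfold)
  also have "\<dots> = (\<Sum>i\<in>{0..d}. replicate_mset (l i) (q_pm r 1 (q i)) + replicate_mset (l i) (q_pm r (-1) (q i)))"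
    by (simp add: sum_single_mset_const flip: sum.cartesian_product)
  finally have spectrum: "?spec = replicate_mset (m - n) (2 * real r - 2) +
      (\<Sum>i\<in>{0..d}. replicate_mset (l i) (q_pm r 1 (q i)) + replicate_mset (l i) (q_pm r (-1) (q i)))"
    by (simp add: sum_single_mset_const)
  have kernel_neq: "2 * real r - 2 \<noteq> q_pm r s (q i)" if "i \<le> d" "s \<in> {1, -1}" for i s
    using q_pm_neq[OF q_pos[OF that(1)] that(2) r] by simp
  have count_kernel: "count ?spec (2 * real r - 2) = m - n"
    unfolding spectrum by (simp add: count_sum kernel_neq)
  have count_pm: "count ?spec (q_pm r s (q i)) = l i" if i: "i \<le> d" and s: "s \<in> {1, -1}" for i s
  proof -
    have eq: "q_pm r s (q i) = q_pm r s' (q i') \<longleftrightarrow> i = i' \<and> s = s'"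
      if "i' \<le> d" "s' \<in> {1, -1}" for i' s'
      using q_pm_inject[OF q_pos[OF i] s q_pos[OF that(1)] that(2) r] q_inj[OF i that(1)] by blast
    \<comment> \<open>By \<open>eq\<close> and \<open>kernel_neq\<close>, only the block with the
      same index and sign contributes.\<close>
    have "count ?spec (q_pm r s (q i)) = (\<Sum>i'\<in>{0..d}. if i' = i then l i else 0)"
      unfolding spectrum using kernel_neq[OF i s] s
      by (auto simp: count_sum eq intro!: sum.cong)
    also have "\<dots> = l i"
      using i by simp
    finally show ?thesis .
  qed
  show ?thesis
    using spectrum count_kernel count_pm Y_eigen X_eigen YY YX XX by simp
qed

end
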